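(* Consider the linear system $x_{t+1}=Ax_t+Bu_t+w_t$, $y_t=Cx_t+Du_t$, $t=0,1,\dots$, with $A\in\mathbb{R}^{n\times n}$, $B\in\mathbb{R}^{n\times m}$, $C\in\mathbb{R}^{r\times n}$, $D\in\mathbb{R}^{r\times m}$, and let $k\ge 1$, $T\ge 1$ be integers. Suppose that $A^{2k-1}=0$. Let $G_k^*=[D\ \ CB\ \ CAB\ \cdots\ CA^{2k-2}B]\in\mathbb{R}^{r\times 2km}$. If $$\sum_{t=2k-1}^{T+2k-2}\mathbb{I}\{v_t^i=0\}\cdot |s^T\mathbf{U}_t^{(k)}|>0\qquad\text{for all } s\in\mathbb{S}^{2km-1}$$ holds for all $i\in\{1,\dots,r\}$, then $G_k^*$ is the unique solution of the $\ell_1$-norm estimation problem $$\min_{G\in\mathbb{R}^{r\times 2km}}\ \sum_{t=2k-1}^{T+2k-2}\|y_t-G\,\mathbf{U}_t^{(k)}\|_1 .$$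
   Context: $x_t\in\mathbb{R}^n$ is the state, $u_t\in\mathbb{R}^m$ the control input, $y_t\in\mathbb{R}^r$ the observation, and $w_t\in\mathbb{R}^n$ the attack at time $t$. For $t\ge 2k-1$ set $\mathbf{U}_t^{(k)}=[u_t^T\ u_{t-1}^T\ \cdots\ u_{t-2k+1}^T]^T\in\mathbb{R}^{2km}$ and $$v_t=\sum_{j=0}^{2k-2}CA^jw_{t-1-j}\in\mathbb{R}^r,$$ so that $y_t=G_k^*\mathbf{U}_t^{(k)}+v_t+CA^{2k-1}x_{t-2k+1}$; $v_t^i$ denotes the $i$-th entry of $v_t$. For an event $E$, $\mathbb{I}\{E\}$ equals $1$ if $E$ occurs and $-1$ otherwise (note: $-1$, not $0$). $\mathbb{S}^{N-1}=\{y\in\mathbb{R}^N:\|y\|_2=1\}$. The statement is for a given realization (trajectory) of the inputs and attacks. *)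

theory Defs
  imports "HOL-Analysis.L2_Norm" "Jordan_Normal_Form.Matrix"
begin

definition lti_system ::
  "real mat \<Rightarrow> real mat \<Rightarrow> real mat \<Rightarrow> real mat \<Rightarrow> (nat \<Rightarrow> real vec) \<Rightarrow> (nat \<Rightarrow> real vec) \<Rightarrow>
   (nat \<Rightarrow> real vec) \<Rightarrow> (nat \<Rightarrow> real vec) \<Rightarrow> bool"
where
  "lti_system A B C D x u w y \<longleftrightarrow>
     (\<forall>t. x (Suc t) = A *\<^sub>v x t + B *\<^sub>v u t + w t \<and> y t = C *\<^sub>v x t + D *\<^sub>v u t)"

definition markov_block ::
  "real mat \<Rightarrow> real mat \<Rightarrow> real mat \<Rightarrow> real mat \<Rightarrow> nat \<Rightarrow> real mat"
where
  "markov_block A B C D p = (if p = 0 then D else C * (A ^\<^sub>m (p - 1)) * B)"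

(* The r x 2km matrix [D, C B, C A B, ..., C A^(2k-2) B]: column j is column (j mod m)
   of block number (j div m), the blocks being numbered 0, ..., 2k-1 from the left. *)
definition markov_mat ::
  "nat \<Rightarrow> nat \<Rightarrow> nat \<Rightarrow> real mat \<Rightarrow> real mat \<Rightarrow> real mat \<Rightarrow> real mat \<Rightarrow> real mat"
where
  "markov_mat r m k A B C D =
     mat r (2 * k * m) (\<lambda>(i, j). markov_block A B C D (j div m) $$ (i, j mod m))"

(* The vector [u_t; u_(t-1); ...; u_(t-2k+1)], meaningful for t \<ge> 2k-1, so that the
   subtraction t - p with p \<le> 2k-1 never truncates. *)
definition input_stack :: "nat \<Rightarrow> nat \<Rightarrow> (nat \<Rightarrow> real vec) \<Rightarrow> nat \<Rightarrow> real vec" where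
  "input_stack m k u t = vec (2 * k * m) (\<lambda>j. u (t - j div m) $ (j mod m))"

(* The sum of C A^j w_(t-1-j) over j = 0, ..., 2k-2, again meaningful for k \<ge> 1 and t \<ge> 2k-1. *)
definition attack_effect ::
  "nat \<Rightarrow> nat \<Rightarrow> real mat \<Rightarrow> real mat \<Rightarrow> (nat \<Rightarrow> real vec) \<Rightarrow> nat \<Rightarrow> real vec"
where
  "attack_effect r k A C w t =
     finsum_vec TYPE(real) r (\<lambda>j. (C * (A ^\<^sub>m j)) *\<^sub>v w (t - 1 - j)) {0..2 * k - 2}"

definition sign_ind :: "bool \<Rightarrow> real" where
  "sign_ind P = (if P then 1 else - 1)"

definition unit_sphere :: "nat \<Rightarrow> real vec set" where
  "unit_sphere N = {s \<in> carrier_vec N. L2_set (\<lambda>i. s $ i) {0..<N} = 1}"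

definition l1_norm_vec :: "real vec \<Rightarrow> real" where
  "l1_norm_vec z = (\<Sum>i = 0..<dim_vec z. \<bar>z $ i\<bar>)"

definition l1_loss ::
  "nat \<Rightarrow> nat \<Rightarrow> nat \<Rightarrow> (nat \<Rightarrow> real vec) \<Rightarrow> (nat \<Rightarrow> real vec) \<Rightarrow> real mat \<Rightarrow> real"
where
  "l1_loss m k T u y G =
     (\<Sum>t = 2 * k - 1..T + 2 * k - 2. l1_norm_vec (y t - G *\<^sub>v input_stack m k u t))"

end

theory Submission
  imports Defs
begin

text \<open>
  Write $G^*$ for the Markov matrix, $U_t$ for the stacked inputs and $v_t$ for the effect of
  the attacks. Unrolling the dynamics over $2k-1$ steps expresses the output through the last
  $2k$ inputs, the last $2k-1$ attacks and the term $C A^{2k-1} x_{t-2k+1}$, and nilpotency kills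
  that last term (\<open>output_eq_markov_plus_attack\<close>). Hence $y_t = G^* U_t + v_t$, and the
  residual of a candidate $G$ is $v_t + (G^* - G) U_t$.

  The $\ell_1$ loss separates over the rows. In row $i$, let $s$ be the difference of the
  $i$-th rows of $G^*$ and $G$. Replacing $v_t^i$ by $v_t^i + s^T U_t$ increases the absolute
  value by exactly $|s^T U_t|$ if $v_t^i = 0$, and decreases it by at most $|s^T U_t|$ otherwise
  (\<open>sign_ind_mult_abs_le\<close>). So the excess loss of $G$ over $G^*$ is at least the sum
  over the rows of the expressions in the hypothesis, taken at the vectors $s$
  (\<open>l1_loss_excess_ge\<close>). These expressions are homogeneous in $s$, so positivity on
  the sphere gives positivity at every nonzero $s$ (\<open>pos_of_pos_on_unit_sphere\<close>). A
  matrix $G \<noteq> G^*$ has at least one nonzero row difference and thus strictly larger loss.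
\<close>

section \<open>Unrolling the dynamics\<close>

text \<open>
  The factor $C$ and the choice of a component are built into the statement so that the
  accumulated inputs and attacks form a sum of real numbers. The induction replaces the oldest
  state $x_{t-q}$ by its one-step update, which is where $q \<le> t$ is needed.
\<close>
lemma lti_state_unroll:
  fixes A B C D :: "real mat"
  assumes A: "A \<in> carrier_mat n n"
    and B: "B \<in> carrier_mat n m"
    and C: "C \<in> carrier_mat r n"
    and x: "\<And>t. x t \<in> carrier_vec n"
    and u: "\<And>t. u t \<in> carrier_vec m"
    and w: "\<And>t. w t \<in> carrier_vec n"
    and sys: "lti_system A B C D x u w y"
    and i: "i < r"
    and q: "q \<le> t"
  shows "(C *\<^sub>v x t) $ i = ((C * A ^\<^sub>m q) *\<^sub>v x (t - q)) $ i
           + (\<Sum>j<q. ((C * A ^\<^sub>m j * B) *\<^sub>v u (t - 1 - j)) $ i)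
           + (\<Sum>j<q. ((C * A ^\<^sub>m j) *\<^sub>v w (t - 1 - j)) $ i)"
  using q
proof (induction q)
  case 0
  then show ?case using A C by simp
next
  case (Suc q)
  define z where "z = t - Suc q"
  have tq: "t - q = Suc z" "t - 1 - q = z" using Suc.prems by (auto simp: z_def)
  define M where "M = C * A ^\<^sub>m q"
  have M: "M \<in> carrier_mat r n" unfolding M_def using A C by auto
  have step: "x (Suc z) = A *\<^sub>v x z + B *\<^sub>v u z + w z"
    using sys by (auto simp: lti_system_def)
  have "M *\<^sub>v x (Suc z) = M *\<^sub>v (A *\<^sub>v x z + B *\<^sub>v u z) + M *\<^sub>v w z"
    unfolding step using mult_add_distrib_mat_vec[OF M _ w] A B x u by auto
  also have "M *\<^sub>v (A *\<^sub>v x z + B *\<^sub>v u z) = M *\<^sub>v (A *\<^sub>v x z) + M *\<^sub>v (B *\<^sub>v u z)"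
    using mult_add_distrib_mat_vec[OF M] A B x u by auto
  also have "M *\<^sub>v (A *\<^sub>v x z) = (M * A) *\<^sub>v x z"
    using assoc_mult_mat_vec[OF M A x] by simp
  also have "M *\<^sub>v (B *\<^sub>v u z) = (M * B) *\<^sub>v u z"
    using assoc_mult_mat_vec[OF M B u] by simp
  finally have "M *\<^sub>v x (Suc z) = (M * A) *\<^sub>v x z + (M * B) *\<^sub>v u z + M *\<^sub>v w z" .
  moreover have MA: "M * A = C * A ^\<^sub>m (Suc q)"
    unfolding M_def using assoc_mult_mat[OF C _ A, of "A ^\<^sub>m q"] A by simp
  ultimately have "M *\<^sub>v x (Suc z)
      = (C * A ^\<^sub>m (Suc q)) *\<^sub>v x z + (M * B) *\<^sub>v u z + M *\<^sub>v w z"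
    by (simp only: MA)
  then have "(M *\<^sub>v x (Suc z)) $ i
      = ((C * A ^\<^sub>m (Suc q)) *\<^sub>v x z) $ i + ((M * B) *\<^sub>v u z) $ i + (M *\<^sub>v w z) $ i"
    using i M by (simp del: pow_mat.simps index_mult_mat_vec)
  moreover have "(C *\<^sub>v x t) $ i = (M *\<^sub>v x (Suc z)) $ i
           + (\<Sum>j<q. ((C * A ^\<^sub>m j * B) *\<^sub>v u (t - 1 - j)) $ i)
           + (\<Sum>j<q. ((C * A ^\<^sub>m j) *\<^sub>v w (t - 1 - j)) $ i)"
    using Suc.IH Suc.prems unfolding M_def tq(1) by linarith
  ultimately show ?case
    unfolding sum.lessThan_Suc tq(2) z_def[symmetric] M_def[symmetric] by linarith
qed

text \<open>
  Block multiplication: a column index $j < 2km$ is the pair of a block number $j$ div $m$ and a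
  column $j$ mod $m$ of that block, so summing over $j$ is summing over blocks and then columns.
\<close>
lemma markov_mat_mult_input_stack:
  fixes A B C D :: "real mat"
  assumes B: "B \<in> carrier_mat n m"
    and C: "C \<in> carrier_mat r n"
    and D: "D \<in> carrier_mat r m"
    and u: "\<And>t. u t \<in> carrier_vec m"
    and i: "i < r"
  shows "(markov_mat r m k A B C D *\<^sub>v input_stack m k u t) $ i
           = (\<Sum>p<2 * k. (markov_block A B C D p *\<^sub>v u (t - p)) $ i)"
proof -
  let ?f = "\<lambda>j. markov_block A B C D (j div m) $$ (i, j mod m) * u (t - j div m) $ (j mod m)"
  have block: "dim_row (markov_block A B C D p) = r" "dim_col (markov_block A B C D p) = m" for p
    using B C D by (auto simp: markov_block_def)
  have "(markov_mat r m k A B C D *\<^sub>v input_stack m k u t) $ i = (\<Sum>j<2 * k * m. ?f j)"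
    using i by (simp add: markov_mat_def input_stack_def scalar_prod_def lessThan_atLeast0)
  also have "\<dots> = (\<Sum>p<2 * k. sum ?f {p * m..<p * m + m})"
    by (rule sum.nat_group[symmetric])
  also have "\<dots> = (\<Sum>p<2 * k. (markov_block A B C D p *\<^sub>v u (t - p)) $ i)"
  proof (rule sum.cong[OF refl])
    fix p
    have "sum ?f {p * m..<p * m + m} = (\<Sum>c = 0..<m. ?f (c + p * m))"
      using sum.shift_bounds_nat_ivl[of ?f 0 "p * m" m] by (simp add: add.commute)
    also have "\<dots> = (\<Sum>c = 0..<m. markov_block A B C D p $$ (i, c) * u (t - p) $ c)"
      by (rule sum.cong) auto
    also have "\<dots> = (markov_block A B C D p *\<^sub>v u (t - p)) $ i"
      using i block u[of "t - p"] by (simp add: scalar_prod_def)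
    finally show "sum ?f {p * m..<p * m + m} = (markov_block A B C D p *\<^sub>v u (t - p)) $ i" .
  qed
  finally show ?thesis .
qed

lemma attack_effect_index:
  assumes C: "C \<in> carrier_mat r n"
    and k: "k \<ge> 1"
    and i: "i < r"
  shows "attack_effect r k A C w t $ i
           = (\<Sum>j<2 * k - 1. ((C * A ^\<^sub>m j) *\<^sub>v w (t - 1 - j)) $ i)"
proof -
  have range: "{0..2 * k - 2} = {..<2 * k - 1}" using k by auto
  have "(\<lambda>j. (C * A ^\<^sub>m j) *\<^sub>v w (t - 1 - j)) \<in> {0..2 * k - 2} \<rightarrow> carrier_vec r"
    using C by (intro Pi_I carrier_vecI) simp
  from index_finsum_vec[OF _ i this] show ?thesis
    unfolding attack_effect_def range by simp
qed

lemma output_eq_markov_plus_attack: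
  fixes A B C D :: "real mat"
  assumes A: "A \<in> carrier_mat n n"
    and B: "B \<in> carrier_mat n m"
    and C: "C \<in> carrier_mat r n"
    and D: "D \<in> carrier_mat r m"
    and x: "\<And>t. x t \<in> carrier_vec n"
    and u: "\<And>t. u t \<in> carrier_vec m"
    and w: "\<And>t. w t \<in> carrier_vec n"
    and sys: "lti_system A B C D x u w y"
    and k: "k \<ge> 1"
    and nilpotent: "A ^\<^sub>m (2 * k - 1) = 0\<^sub>m n n"
    and t: "2 * k - 1 \<le> t"
    and i: "i < r"
  shows "y t $ i = (markov_mat r m k A B C D *\<^sub>v input_stack m k u t) $ i
                   + attack_effect r k A C w t $ i"
proof -
  have "((C * A ^\<^sub>m (2 * k - 1)) *\<^sub>v x (t - (2 * k - 1))) $ i = 0"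
    using nilpotent C i x[of "t - (2 * k - 1)"] by simp
  with lti_state_unroll[OF A B C x u w sys i t] attack_effect_index[OF C k i]
  have Cx: "(C *\<^sub>v x t) $ i
      = (\<Sum>j<2 * k - 1. ((C * A ^\<^sub>m j * B) *\<^sub>v u (t - 1 - j)) $ i)
        + attack_effect r k A C w t $ i"
    by simp
  (* Block 0 is D; block Suc j is C A^j B, which meets the input at time t - 1 - j. *)
  have "(\<Sum>p<Suc (2 * k - 1). (markov_block A B C D p *\<^sub>v u (t - p)) $ i)
      = (D *\<^sub>v u t) $ i + (\<Sum>j<2 * k - 1. ((C * A ^\<^sub>m j * B) *\<^sub>v u (t - 1 - j)) $ i)"
    unfolding sum.lessThan_Suc_shift by (simp add: markov_block_def)
  moreover have "Suc (2 * k - 1) = 2 * k" using k by simp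
  ultimately have GU: "(markov_mat r m k A B C D *\<^sub>v input_stack m k u t) $ i
      = (D *\<^sub>v u t) $ i + (\<Sum>j<2 * k - 1. ((C * A ^\<^sub>m j * B) *\<^sub>v u (t - 1 - j)) $ i)"
    using markov_mat_mult_input_stack[OF B C D u i] by simp
  have "y t = C *\<^sub>v x t + D *\<^sub>v u t" using sys by (simp add: lti_system_def)
  then have "y t $ i = (C *\<^sub>v x t) $ i + (D *\<^sub>v u t) $ i" using C D i by simp
  with Cx GU show ?thesis by linarith
qed

section \<open>Excess loss\<close>

text \<open>
  The sharp perturbation bound for the absolute value: at $a = 0$ it is an equality, and
  elsewhere it is the triangle inequality. This is why the value $-1$, and not $0$, is the right
  weight for the times under attack.
\<close>
lemma sign_ind_mult_abs_le: "sign_ind (a = 0) * \<bar>b\<bar> \<le> \<bar>a + b\<bar> - \<bar>a\<bar>"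
  using abs_triangle_ineq2[of a "- b"] by (simp add: sign_ind_def)

text \<open>
  Entry $i$ of the residual is $v_t^i$ for $H$ and $v_t^i + s^T U_t$ for $G$, with $s$ the
  difference of the $i$-th rows. The perturbation bound therefore applies to each entry at each
  time, whatever the sequence $v$ is.
\<close>
lemma l1_loss_excess_ge:
  fixes G H :: "real mat"
  assumes G: "G \<in> carrier_mat r (2 * k * m)"
    and H: "H \<in> carrier_mat r (2 * k * m)"
    and y: "\<And>t i. 2 * k - 1 \<le> t \<Longrightarrow> i < r
              \<Longrightarrow> y t $ i = (H *\<^sub>v input_stack m k u t) $ i + v t $ i"
  shows "(\<Sum>i<r. \<Sum>t = 2 * k - 1..T + 2 * k - 2.
            sign_ind (v t $ i = 0) * \<bar>(row H i - row G i) \<bullet> input_stack m k u t\<bar>)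
         \<le> l1_loss m k T u y G - l1_loss m k T u y H"
proof -
  let ?U = "input_stack m k u"
  have U: "?U t \<in> carrier_vec (2 * k * m)" for t by (simp add: input_stack_def)
  have norm: "l1_norm_vec (y t - F *\<^sub>v ?U t) = (\<Sum>i<r. \<bar>y t $ i - (F *\<^sub>v ?U t) $ i\<bar>)"
    if "F \<in> carrier_mat r (2 * k * m)" for F t
    unfolding l1_norm_vec_def lessThan_atLeast0 using that by (intro sum.cong) auto
  have "(\<Sum>i<r. \<Sum>t = 2 * k - 1..T + 2 * k - 2.
            sign_ind (v t $ i = 0) * \<bar>(row H i - row G i) \<bullet> ?U t\<bar>)
      = (\<Sum>t = 2 * k - 1..T + 2 * k - 2. \<Sum>i<r.
            sign_ind (v t $ i = 0) * \<bar>(row H i - row G i) \<bullet> ?U t\<bar>)"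
    by (rule sum.swap)
  also have "\<dots> \<le> (\<Sum>t = 2 * k - 1..T + 2 * k - 2.
      l1_norm_vec (y t - G *\<^sub>v ?U t) - l1_norm_vec (y t - H *\<^sub>v ?U t))"
    unfolding norm[OF G] norm[OF H] sum_subtractf[symmetric]
  proof (intro sum_mono)
    fix t i assume "t \<in> {2 * k - 1..T + 2 * k - 2}" "i \<in> {..<r}"
    then have t: "2 * k - 1 \<le> t" and i: "i < r" by auto
    have "(row H i - row G i) \<bullet> ?U t = row H i \<bullet> ?U t - row G i \<bullet> ?U t"
      using minus_scalar_prod_distrib[of "row H i" "2 * k * m" "row G i" "?U t"] G H i U by auto
    then have "(row H i - row G i) \<bullet> ?U t = (H *\<^sub>v ?U t) $ i - (G *\<^sub>v ?U t) $ i"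
      using G H i by simp
    then have "y t $ i - (G *\<^sub>v ?U t) $ i = v t $ i + (row H i - row G i) \<bullet> ?U t"
      and "y t $ i - (H *\<^sub>v ?U t) $ i = v t $ i"
      using y[OF t i] by linarith+
    then show "sign_ind (v t $ i = 0) * \<bar>(row H i - row G i) \<bullet> ?U t\<bar>
        \<le> \<bar>y t $ i - (G *\<^sub>v ?U t) $ i\<bar> - \<bar>y t $ i - (H *\<^sub>v ?U t) $ i\<bar>"
      by (simp only: sign_ind_mult_abs_le)
  qed
  also have "\<dots> = l1_loss m k T u y G - l1_loss m k T u y H"
    by (simp add: l1_loss_def sum_subtractf)
  finally show ?thesis .
qed

text \<open>The sum is positively homogeneous in $s$, so its sign does not change when $s$ is normalised.\<close>
lemma pos_of_pos_on_unit_sphere: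
  fixes c :: "'t \<Rightarrow> real" and U :: "'t \<Rightarrow> real vec"
  assumes U: "\<And>t. U t \<in> carrier_vec N"
    and pos: "\<And>s. s \<in> unit_sphere N \<Longrightarrow> (\<Sum>t\<in>S. c t * \<bar>s \<bullet> U t\<bar>) > 0"
    and s: "s \<in> carrier_vec N"
    and nz: "s \<noteq> 0\<^sub>v N"
  shows "(\<Sum>t\<in>S. c t * \<bar>s \<bullet> U t\<bar>) > 0"
proof -
  define l where "l = L2_set (\<lambda>i. s $ i) {0..<N}"
  obtain j where "j < N" "s $ j \<noteq> 0"
    using s nz by (metis carrier_vecD eq_vecI index_zero_vec(1,2))
  then have "l \<noteq> 0" unfolding l_def by (auto simp: L2_set_eq_0_iff)
  then have l: "l > 0" unfolding l_def by (simp add: L2_set_nonneg less_le)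
  have "L2_set (\<lambda>i. ((1 / l) \<cdot>\<^sub>v s) $ i) {0..<N} = L2_set (\<lambda>i. (1 / l) * s $ i) {0..<N}"
    using s by (intro L2_set_cong) auto
  also have "\<dots> = (1 / l) * l"
    unfolding l_def by (rule L2_set_right_distrib[symmetric]) (simp add: L2_set_nonneg)
  finally have "(1 / l) \<cdot>\<^sub>v s \<in> unit_sphere N"
    using s l by (simp add: unit_sphere_def)
  from pos[OF this] have "0 < (\<Sum>t\<in>S. c t * \<bar>((1 / l) \<cdot>\<^sub>v s) \<bullet> U t\<bar>)" .
  also have "\<dots> = (1 / l) * (\<Sum>t\<in>S. c t * \<bar>s \<bullet> U t\<bar>)"
    unfolding sum_distrib_left
  proof (rule sum.cong[OF refl])
    fix t
    have "((1 / l) \<cdot>\<^sub>v s) \<bullet> U t = (1 / l) * (s \<bullet> U t)"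
      using s U[of t] by (intro smult_scalar_prod_distrib)
    then show "c t * \<bar>((1 / l) \<cdot>\<^sub>v s) \<bullet> U t\<bar> = (1 / l) * (c t * \<bar>s \<bullet> U t\<bar>)"
      using l by (simp add: abs_mult)
  qed
  finally show ?thesis using l by (simp add: zero_less_divide_iff)
qed

section \<open>Exact recovery\<close>

theorem theorem1:
  fixes n m r k T :: nat
    and A B C D :: "real mat"
    and x u w y :: "nat \<Rightarrow> real vec"
  assumes A: "A \<in> carrier_mat n n"
    and B: "B \<in> carrier_mat n m"
    and C: "C \<in> carrier_mat r n"
    and D: "D \<in> carrier_mat r m"
    and x: "\<And>t. x t \<in> carrier_vec n"
    and u: "\<And>t. u t \<in> carrier_vec m"
    and w: "\<And>t. w t \<in> carrier_vec n"
    and y: "\<And>t. y t \<in> carrier_vec r"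
    and sys: "lti_system A B C D x u w y"
    and k: "k \<ge> 1"
    and T: "T \<ge> 1"
    and nilpotent: "A ^\<^sub>m (2 * k - 1) = 0\<^sub>m n n"
    and condition: "\<And>i s. i < r \<Longrightarrow> s \<in> unit_sphere (2 * k * m) \<Longrightarrow>
      (\<Sum>t = 2 * k - 1..T + 2 * k - 2.
         sign_ind (attack_effect r k A C w t $ i = 0) * \<bar>s \<bullet> input_stack m k u t\<bar>) > 0"
  shows "{G. is_arg_min (l1_loss m k T u y) (\<lambda>G. G \<in> carrier_mat r (2 * k * m)) G}
         = {markov_mat r m k A B C D}"
proof -
  let ?N = "2 * k * m"
  let ?H = "markov_mat r m k A B C D"
  let ?U = "input_stack m k u"
  let ?v = "attack_effect r k A C w"
  let ?L = "l1_loss m k T u y"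
  let ?gap = "\<lambda>i s. \<Sum>t = 2 * k - 1..T + 2 * k - 2. sign_ind (?v t $ i = 0) * \<bar>s \<bullet> ?U t\<bar>"
  have H: "?H \<in> carrier_mat r ?N" by (simp add: markov_mat_def)
  have U: "?U t \<in> carrier_vec ?N" for t by (simp add: input_stack_def)
  have gap_pos: "?gap i s > 0" if "i < r" "s \<in> carrier_vec ?N" "s \<noteq> 0\<^sub>v ?N" for i s
    using pos_of_pos_on_unit_sphere[OF U condition[OF that(1)] that(2,3)] by simp
  have strict: "?L ?H < ?L G" if G: "G \<in> carrier_mat r ?N" and ne: "G \<noteq> ?H" for G
  proof -
    define d where "d = (\<lambda>i. row ?H i - row G i)"
    have d: "d i \<in> carrier_vec ?N" if "i < r" for i
      using G H that by (auto simp: d_def)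
    have gap_nonneg: "?gap i (d i) \<ge> 0" if "i < r" for i
      using gap_pos[OF that d[OF that]] U by (cases "d i = 0\<^sub>v ?N") auto
    from ne G H obtain i j where i: "i < r" and j: "j < ?N" and "G $$ (i, j) \<noteq> ?H $$ (i, j)"
      by (metis carrier_matD eq_matI)
    then have "d i $ j \<noteq> 0" using G H by (simp add: d_def)
    then have "d i \<noteq> 0\<^sub>v ?N" using j by auto
    then have "?gap i (d i) > 0" using gap_pos[OF i d[OF i]] by simp
    then have "0 < (\<Sum>i<r. ?gap i (d i))"
      using i gap_nonneg by (intro sum_pos2[of "{..<r}" i]) auto
    also have "\<dots> \<le> ?L G - ?L ?H"
      unfolding d_def
      by (rule l1_loss_excess_ge[OF G H])
        (rule output_eq_markov_plus_attack[OF A B C D x u w sys k nilpotent])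
    finally show ?thesis by simp
  qed
  have "is_arg_min ?L (\<lambda>G. G \<in> carrier_mat r ?N) G \<longleftrightarrow> G = ?H" for G
    unfolding is_arg_min_def using H strict less_asym by blast
  then show ?thesis by blast
qed

end
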